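(* Let $D\subseteq[n]^2$ and $\alpha=(\alpha_1,\dots,\alpha_n)\in\mathbb{Z}_{\ge0}^n$. Then $\alpha\in\mathcal{S}_D$ (the Schubitope of $D$) if and only if $\mathsf{PerfectTab}(D,\alpha)\neq\emptyset$.
   Context: Fix $n\in\mathbb{Z}_{>0}$. A diagram is a subset $D\subseteq[n]^2$, where $(r,c)$ is the box in the $r$th row from the top and $c$th column from the left of an $n\times n$ grid. Given $S\subseteq[n]$ and a column $c\in[n]$, the string $\mathsf{word}_{c,S}(D)$ is obtained by reading column $c$ from top to bottom ($r=1,\dots,n$) and recording: "$($" if $(r,c)\notin D$ and $r\in S$; "$)$" if $(r,c)\in D$ and $r\notin S$; "$\star$" if $(r,c)\in D$ and $r\in S$; nothing otherwise. Parentheses are paired by the standard inside-out matching (ignoring $\star$'s). Let $\theta_D^c(S)$ be the number of $\star$'s in $\mathsf{word}_{c,S}(D)$ plus the number of matched pairs $()$ in $\mathsf{word}_{c,S}(D)$, and let $\theta_D(S)=\sum_{c=1}^n\theta_D^c(S)$. The Schubitope is $$\mathcal{S}_D=\Big\{(\alpha_1,\dots,\alpha_n)\in\mathbb{R}_{\ge0}^n:\ \alpha_1+\dots+\alpha_n=\#D\ \text{ and }\ \sum_{i\in S}\alpha_i\le\theta_D(S)\text{ for all }S\subseteq[n]\Big\}.$$ A tableau of shape $D$ is a map $\tau:D\to[n]\cup\{\circ\}$, where $\circ$ means "unlabelled". It is flagged if $\tau(r,c)\le r$ whenever $\tau(r,c)\ne\circ$; column-injective if $\tau(r,c)\neq\tau(r',c)$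 whenever $r\ne r'$ and $\tau(r,c)\neq\circ$; perfect if it is flagged, column-injective, and $\tau^{-1}(\{\circ\})=\emptyset$. It has content $\alpha$ if $\#\tau^{-1}(\{i\})=\alpha_i$ for each $i\in[n]$. $\mathsf{PerfectTab}(D,\alpha)$ is the set of perfect tableaux of shape $D$ and content $\alpha$. *)

theory Defs
  imports Complex_Main "HOL-Library.FuncSet"
begin

type_synonym box = "nat \<times> nat"

datatype token = Open | Close | Star

definition column_word :: "nat \<Rightarrow> box set \<Rightarrow> nat \<Rightarrow> nat set \<Rightarrow> token list" where
  "column_word n D c S = concat (map (\<lambda>r.
     if (r, c) \<notin> D \<and> r \<in> S then [Open]
     else if (r, c) \<in> D \<and> r \<notin> S then [Close]
     else if (r, c) \<in> D \<and> r \<in> S then [Star]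
     else []) [1..<Suc n])"

text \<open>Inside-out matching, by positions: an opening and a later closing parenthesis are paired once
  all parentheses strictly between them have been paired among themselves.\<close>

inductive paired :: "token list \<Rightarrow> nat \<Rightarrow> nat \<Rightarrow> bool" for w where
  pair: "\<lbrakk>i < j; j < length w; w ! i = Open; w ! j = Close;
    \<And>k. \<lbrakk>i < k; k < j; w ! k \<noteq> Star\<rbrakk> \<Longrightarrow>
      \<exists>l. i < l \<and> l < j \<and> (paired w k l \<or> paired w l k)\<rbrakk>
    \<Longrightarrow> paired w i j"

definition theta_col :: "nat \<Rightarrow> box set \<Rightarrow> nat \<Rightarrow> nat set \<Rightarrow> nat" where
  "theta_col n D c S =
     count_list (column_word n D c S) Star + card {(i, j). paired (column_word n D c S) i j}"

definition theta :: "nat \<Rightarrow> box set \<Rightarrow> nat set \<Rightarrow> nat" where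
  "theta n D S = (\<Sum>c = 1..n. theta_col n D c S)"

text \<open>A point of \<open>\<real>\<^sup>n\<close> is a function on \<open>{1..n}\<close>, extended by \<^const>\<open>undefined\<close>.\<close>

definition schubitope :: "nat \<Rightarrow> box set \<Rightarrow> (nat \<Rightarrow> real) set" where
  "schubitope n D = {a \<in> {1..n} \<rightarrow>\<^sub>E {0..}.
     (\<Sum>i = 1..n. a i) = real (card D) \<and>
     (\<forall>S \<subseteq> {1..n}. (\<Sum>i\<in>S. a i) \<le> real (theta n D S))}"

text \<open>The value \<^const>\<open>None\<close> stands for an unlabelled box.\<close>

definition tableaux :: "nat \<Rightarrow> box set \<Rightarrow> (box \<Rightarrow> nat option) set" where
  "tableaux n D = D \<rightarrow>\<^sub>E insert None (Some ` {1..n})"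

definition flagged :: "box set \<Rightarrow> (box \<Rightarrow> nat option) \<Rightarrow> bool" where
  "flagged D \<tau> \<longleftrightarrow> (\<forall>(r, c) \<in> D. \<forall>i. \<tau> (r, c) = Some i \<longrightarrow> i \<le> r)"

definition column_injective :: "box set \<Rightarrow> (box \<Rightarrow> nat option) \<Rightarrow> bool" where
  "column_injective D \<tau> \<longleftrightarrow>
     (\<forall>r r' c. (r, c) \<in> D \<longrightarrow> (r', c) \<in> D \<longrightarrow> r \<noteq> r' \<longrightarrow> \<tau> (r, c) \<noteq> None \<longrightarrow>
        \<tau> (r, c) \<noteq> \<tau> (r', c))"

definition perfect :: "box set \<Rightarrow> (box \<Rightarrow> nat option) \<Rightarrow> bool" where
  "perfect D \<tau> \<longleftrightarrow> flagged D \<tau> \<and> column_injective D \<tau> \<and> {b \<in> D. \<tau> b = None} = {}"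

definition has_content :: "nat \<Rightarrow> box set \<Rightarrow> (box \<Rightarrow> nat option) \<Rightarrow> (nat \<Rightarrow> nat) \<Rightarrow> bool" where
  "has_content n D \<tau> \<alpha> \<longleftrightarrow> (\<forall>i \<in> {1..n}. card {b \<in> D. \<tau> b = Some i} = \<alpha> i)"

definition perfect_tab :: "nat \<Rightarrow> box set \<Rightarrow> (nat \<Rightarrow> nat) \<Rightarrow> (box \<Rightarrow> nat option) set" where
  "perfect_tab n D \<alpha> = {\<tau> \<in> tableaux n D. perfect D \<tau> \<and> has_content n D \<tau> \<alpha>}"

end

theory Submission
  imports Defs
begin

text \<open>Write \<open>R\<close> for the rows of \<open>D\<close> in column \<open>c\<close>. Splitting the matching at the first unpaired opening
  parenthesis shows that \<open>\<theta>\<close> of the column is the minimum over \<open>m\<close> of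
  \<open>card (S \<inter> [1, m)) + card (R \<inter> [m, n])\<close>. That such an expression bounds the number of entries from \<open>S\<close>
  in a flagged injective column is clear, which gives one direction. For the other, a perfect tableau is
  an integral flow of value \<open>card D\<close> from the values \<open>i\<close> (with supply \<open>\<alpha> i\<close>) through the nodes \<open>(i, c)\<close>
  (with capacity one) into the boxes \<open>(r, c)\<close> with \<open>i \<le> r\<close>. Splitting every node \<open>(i, c)\<close> in two turns
  such a flow into a perfect matching of a bipartite graph, and Hall's condition for this graph
  reduces, column by column, to the minimum formula.\<close>

section \<open>Hall's theorem\<close>

text \<open>Halmos-Vaughan induction. If some nonempty proper subset is tight, it is matched inside
  its neighbourhood and the rest outside of it; otherwise one arbitrary edge can be fixed and
  removed.\<close>

theorem hall:
  assumes "finite A" and "\<And>x. x \<in> A \<Longrightarrow> finite (N x)"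
    and "\<And>X. X \<subseteq> A \<Longrightarrow> card X \<le> card (\<Union>(N ` X))"
  shows "\<exists>f. inj_on f A \<and> (\<forall>x\<in>A. f x \<in> N x)"
  using assms
proof (induction "card A" arbitrary: A N rule: less_induct)
  case less
  note fin = less.prems(1) and finN = less.prems(2) and hall = less.prems(3)
  show ?case
  proof (cases "\<exists>X. X \<subset> A \<and> X \<noteq> {} \<and> card (\<Union>(N ` X)) = card X")
    case True
    then obtain X where X: "X \<subset> A" "X \<noteq> {}" "card (\<Union>(N ` X)) = card X" by blast
    have finX: "finite X" using X fin by (meson finite_subset psubsetE)
    have "card X < card A" using X fin by (simp add: psubset_card_mono)
    then have "\<exists>f. inj_on f X \<and> (\<forall>x\<in>X. f x \<in> N x)"
      by (rule less.hyps) (use X finX finN hall in auto)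
    then obtain f where f: "inj_on f X" "\<forall>x\<in>X. f x \<in> N x" by blast
    define M where "M x = N x - \<Union>(N ` X)" for x
    have "card (A - X) < card A"
      using X fin by (metis Diff_subset finX card_Diff_subset card_gt_0_iff diff_less psubset_imp_subset
          \<open>card X < card A\<close> gr_zeroI not_less_zero)
    then have "\<exists>g. inj_on g (A - X) \<and> (\<forall>x\<in>A - X. g x \<in> M x)"
    proof (rule less.hyps)
      fix Y assume Y: "Y \<subseteq> A - X"
      have finY: "finite Y" using Y fin by (meson finite_Diff finite_subset)
      \<comment> \<open>Hall's condition survives the deletion of the neighbours of
        \<open>X\<close>: apply it to \<open>X \<union> Y\<close> and cancel the tight set
        \<open>X\<close>.\<close>
      have "card X + card Y = card (X \<union> Y)"
        using Y finX finY by (subst card_Un_disjoint) auto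
      also have "\<dots> \<le> card (\<Union>(N ` (X \<union> Y)))" using Y X by (intro hall) auto
      also have "\<Union>(N ` (X \<union> Y)) = \<Union>(N ` X) \<union> \<Union>(M ` Y)" unfolding M_def by auto
      also have "card \<dots> \<le> card X + card (\<Union>(M ` Y))"
        using card_Un_le[of "\<Union>(N ` X)" "\<Union>(M ` Y)"] X by simp
      finally show "card Y \<le> card (\<Union>(M ` Y))" by simp
    qed (use fin finN in \<open>auto simp: M_def\<close>)
    then obtain g where g: "inj_on g (A - X)" "\<forall>x\<in>A - X. g x \<in> M x" by blast
    define h where "h x = (if x \<in> X then f x else g x)" for x
    have "f ` X \<subseteq> \<Union>(N ` X)" "g ` (A - X) \<subseteq> - \<Union>(N ` X)"
      using f(2) g(2) unfolding M_def by auto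
    then have "f ` X \<inter> g ` (A - X) = {}" by blast
    then have "inj_on h (X \<union> (A - X))"
      unfolding h_def using f(1) g(1) by (intro inj_on_disjoint_Un)
    moreover have "X \<union> (A - X) = A" using X by blast
    ultimately have "inj_on h A" by simp
    moreover have "\<forall>x\<in>A. h x \<in> N x"
      using f(2) g(2) unfolding h_def M_def by simp
    ultimately show ?thesis by blast
  next
    case no_tight: False
    show ?thesis
    proof (cases "A = {}")
      case False
      then obtain a where a: "a \<in> A" by blast
      have "card {a} \<le> card (\<Union>(N ` {a}))" using a by (intro hall) auto
      then obtain b where b: "b \<in> N a" by fastforce
      \<comment> \<open>Without tight sets every nonempty proper subset has a neighbour to spare, so
        the loss of \<open>b\<close> does no harm.\<close>
      define M where "M x = N x - {b}" for x
      have "card (A - {a}) < card A" using a fin by (meson card_Diff1_less)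
      then have "\<exists>g. inj_on g (A - {a}) \<and> (\<forall>x\<in>A - {a}. g x \<in> M x)"
      proof (rule less.hyps)
        fix Y assume Y: "Y \<subseteq> A - {a}"
        show "card Y \<le> card (\<Union>(M ` Y))"
        proof (cases "Y = {}")
          case False
          have "Y \<subset> A" using Y a by blast
          then have "card (\<Union>(N ` Y)) \<noteq> card Y" using no_tight False by metis
          moreover have "card Y \<le> card (\<Union>(N ` Y))" using \<open>Y \<subset> A\<close> by (intro hall) auto
          moreover have "card (\<Union>(N ` Y)) - 1 \<le> card (\<Union>(N ` Y) - {b})"
            by (metis card_Diff_singleton_if diff_le_self order_refl)
          moreover have "\<Union>(N ` Y) - {b} = \<Union>(M ` Y)" unfolding M_def by auto
          ultimately show ?thesis by simp
        qed simp
      qed (use fin finN in \<open>auto simp: M_def\<close>)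
      then obtain g where g: "inj_on g (A - {a})" "\<forall>x\<in>A - {a}. g x \<in> M x" by blast
      have "b \<notin> g ` (A - {a})" using g(2) unfolding M_def by auto
      then have "inj_on (g(a := b)) A"
        using g(1) unfolding inj_on_def by (auto 0 3)
      moreover have "\<forall>x\<in>A. (g(a := b)) x \<in> N x"
        using g b unfolding M_def by auto
      ultimately show ?thesis by blast
    qed simp
  qed
qed

section \<open>Parenthesis matching\<close>

lemma pairedD:
  assumes "paired w i j"
  shows "i < j" "j < length w" "w ! i = Open" "w ! j = Close"
  using assms by (auto elim: paired.cases)

lemma paired_between:
  assumes "paired w i j" "i < k" "k < j" "w ! k \<noteq> Star"
  obtains l where "i < l" "l < j" "paired w k l \<or> paired w l k"
  using assms(1)
proof cases
  case pair
  then show ?thesis using that assms(2-4) by meson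
qed

lemma paired_nested_open:
  assumes "paired w i j" "i < k" "k < j" "w ! k = Open"
  obtains l where "k < l" "l < j" "paired w k l"
  using assms by (metis paired_between pairedD(1,4) token.distinct(1,3))

lemma paired_nested_close:
  assumes "paired w i j" "i < k" "k < j" "w ! k = Close"
  obtains l where "i < l" "l < k" "paired w l k"
  using assms by (metis paired_between pairedD(1,3) token.distinct(1,5))

text \<open>Descent: \<open>j\<close> lies inside the pair from \<open>i\<close> to
  \<open>j'\<close>, so it closes some \<open>l\<close> with \<open>i < l\<close>; but
  \<open>l\<close> lies inside the pair from \<open>i\<close> to \<open>j\<close>, so it also has a
  partner before \<open>j\<close>. Thus \<open>l\<close> has two partners as well, within a shorter
  span.\<close>

lemma paired_right_unique_less:
  assumes "paired w i j" "paired w i j'" "j < j'"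
  shows False
  using assms
proof (induction "j' - i" arbitrary: i j j' rule: less_induct)
  case less
  note p = less.prems
  obtain l where l: "i < l" "l < j" "paired w l j"
    using paired_nested_close[OF p(2) _ p(3)] pairedD[OF p(1)] by metis
  obtain l' where l': "l' < j" "paired w l l'"
    using paired_nested_open[OF p(1) l(1,2)] pairedD[OF l(3)] by metis
  show ?case
    by (rule less.hyps[OF _ l'(2) l(3) l'(1)]) (use l p in auto)
qed

text \<open>The inner opening \<open>i'\<close> is nested in the outer pair, hence has a second
  partner before \<open>j\<close>, which contradicts uniqueness on the right.\<close>

lemma paired_left_unique_less:
  assumes "paired w i j" "paired w i' j" "i < i'"
  shows False
proof -
  obtain l where "l < j" "paired w i' l"
    using paired_nested_open[OF assms(1,3)] pairedD[OF assms(2)] by metis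
  then show False using paired_right_unique_less assms(2) by blast
qed

lemma inj_on_fst_paired: "inj_on fst {(i, j). paired w i j}"
  unfolding inj_on_def by clarsimp (meson linorder_neqE_nat paired_right_unique_less)

lemma inj_on_snd_paired: "inj_on snd {(i, j). paired w i j}"
  unfolding inj_on_def by clarsimp (meson linorder_neqE_nat paired_left_unique_less)

lemma finite_paired: "finite {(i, j). paired w i j}"
  by (rule finite_subset[of _ "{..<length w} \<times> {..<length w}"]) (use pairedD in fastforce)+

section \<open>Counting pairs by cutting the word in two\<close>

lemma count_list_eq_card: "count_list w t = card {i. i < length w \<and> w ! i = t}"
  by (simp add: count_list_eq_length_filter length_filter_conv_card eq_commute)

lemma count_list_take_eq_card:
  "k \<le> length w \<Longrightarrow> count_list (take k w) t = card {i. i < k \<and> w ! i = t}"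
  unfolding count_list_eq_card by (rule arg_cong[of _ _ card]) auto

lemma count_list_drop_eq_card:
  assumes "k \<le> length w"
  shows "count_list (drop k w) t = card {i. k \<le> i \<and> i < length w \<and> w ! i = t}"
proof -
  have "{i. k \<le> i \<and> i < length w \<and> w ! i = t} = (+) k ` {i. i < length (drop k w) \<and> drop k w ! i = t}"
  proof (intro set_eqI iffI)
    fix i assume "i \<in> {i. k \<le> i \<and> i < length w \<and> w ! i = t}"
    then show "i \<in> (+) k ` {i. i < length (drop k w) \<and> drop k w ! i = t}"
      by (intro image_eqI[of _ _ "i - k"]) auto
  qed (use assms in auto)
  then show ?thesis unfolding count_list_eq_card by (simp add: card_image)
qed

text \<open>A pair that opens before the cut is determined by its opening in the prefix; any other
  pair is determined by its closing in the suffix.\<close>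

lemma card_paired_le:
  assumes "k \<le> length w"
  shows "card {(i, j). paired w i j} \<le> count_list (take k w) Open + count_list (drop k w) Close"
proof -
  let ?P = "{(i, j). paired w i j}"
  let ?A = "{p \<in> ?P. fst p < k}" and ?B = "{p \<in> ?P. k \<le> fst p}"
  have "card ?P = card (?A \<union> ?B)" by (rule arg_cong[of _ _ card]) auto
  also have "\<dots> \<le> card ?A + card ?B" by (rule card_Un_le)
  also have "card ?A \<le> count_list (take k w) Open"
    unfolding count_list_take_eq_card[OF assms]
    by (rule card_inj_on_le[of fst]) (auto simp: pairedD intro: inj_on_subset[OF inj_on_fst_paired])
  also have "card ?B \<le> count_list (drop k w) Close"
    unfolding count_list_drop_eq_card[OF assms]
    by (rule card_inj_on_le[of snd])
      (auto simp: pairedD dest: pairedD(1) intro: inj_on_subset[OF inj_on_snd_paired])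
  finally show ?thesis by simp
qed

text \<open>For a closest such pair of positions, everything strictly in between is paired among itself,
  so the two would be paired with each other.\<close>

lemma unpaired_open_close:
  assumes "i < j" "j < length w" "w ! i = Open" "w ! j = Close"
    and "\<nexists>l. paired w i l" "\<nexists>l. paired w l j"
  shows False
  using assms
proof (induction "j - i" arbitrary: i j rule: less_induct)
  case less
  note h = less.prems
  have "\<exists>l>i. l < j \<and> (paired w k l \<or> paired w l k)" if k: "i < k" "k < j" "w ! k \<noteq> Star" for k
  proof (cases "w ! k")
    case Open
    \<comment> \<open>Otherwise \<open>k\<close> and \<open>j\<close> would be a closer unpaired
      couple. The partner \<open>l\<close> cannot lie beyond \<open>j\<close>, since
      \<open>j\<close> would then be nested and hence paired.\<close>
    have "\<exists>l. paired w k l"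
      using less.hyps[of j k] k Open h by (meson diff_less_mono2 order_less_trans)
    then obtain l where l: "paired w k l" by blast
    have "l \<le> j" using paired_nested_close[OF l k(2) _ h(4)] h(6) by (meson not_le)
    then show ?thesis using l h(6) k pairedD(1)[OF l] by (metis le_neq_implies_less order_less_trans)
  next
    case Close
    have "\<exists>l. paired w l k"
      using less.hyps[of k i] k Close h by (meson diff_less_mono order_less_trans less_imp_le)
    then obtain l where l: "paired w l k" by blast
    have "i \<le> l" using paired_nested_open[OF l _ k(1) h(3)] h(5) by (meson not_le)
    then show ?thesis using l h(5) k pairedD(1)[OF l] by (metis le_neq_implies_less order_less_trans)
  qed (use k in simp)
  then have "paired w i j" using h by (intro pair) auto
  then show ?case using h by blast
qed

text \<open>The cut at the first unpaired opening attains the bound of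
  \<open>card_paired_le\<close>: all openings before it are paired by choice, and an unpaired
  closing after it would contradict \<open>unpaired_open_close\<close>.\<close>

lemma card_paired_ge:
  obtains k where "k \<le> length w"
    "count_list (take k w) Open + count_list (drop k w) Close \<le> card {(i, j). paired w i j}"
proof -
  let ?P = "{(i, j). paired w i j}"
  define unpaired where "unpaired i \<longleftrightarrow> i < length w \<and> w ! i = Open \<and> (\<nexists>j. paired w i j)" for i
  \<comment> \<open>If every opening is paired, the cut goes at the end of the word and the suffix
    is empty.\<close>
  define k where "k = (if \<exists>i. unpaired i then LEAST i. unpaired i else length w)"
  have "unpaired k \<or> k = length w" unfolding k_def by (auto intro: LeastI)
  moreover have "\<not> unpaired i" if "i < k" for i
    using that not_less_Least unfolding k_def by (auto split: if_splits)
  ultimately have k: "k \<le> length w" "\<forall>i<k. w ! i = Open \<longrightarrow> (\<exists>j. paired w i j)"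
    "k < length w \<longrightarrow> w ! k = Open \<and> (\<nexists>j. paired w k j)"
    unfolding unpaired_def by auto
  \<comment> \<open>No pair straddles the cut, since \<open>k\<close> would be nested in it and so
    be paired.\<close>
  have nocross: "j < k" if "paired w i j" "i < k" for i j
  proof (rule ccontr)
    assume "\<not> j < k"
    then have "k < length w" "k \<le> j" using pairedD[OF that(1)] by auto
    then have "w ! k = Open" "\<nexists>l. paired w k l" using k(3) by auto
    moreover have "k \<noteq> j" using calculation(1) pairedD[OF that(1)] by auto
    ultimately show False
      using paired_nested_open[OF that(1,2)] \<open>k \<le> j\<close> le_neq_implies_less by blast
  qed
  have closes: "\<exists>i. paired w i j" if "k \<le> j" "j < length w" "w ! j = Close" for j
  proof -
    have kO: "w ! k = Open" "\<nexists>l. paired w k l" using k(3) that(1,2) by auto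
    then have "k < j" using that by (auto simp: nat_less_le)
    then show ?thesis using unpaired_open_close[OF _ that(2) kO(1) that(3) kO(2)] by blast
  qed
  let ?A = "{p \<in> ?P. fst p < k}" and ?B = "{p \<in> ?P. k \<le> fst p}"
  have "{i. i < k \<and> w ! i = Open} \<subseteq> fst ` ?A" using k(2) by force
  then have "count_list (take k w) Open \<le> card ?A"
    unfolding count_list_take_eq_card[OF k(1)] by (rule surj_card_le[rotated]) (simp add: finite_paired)
  moreover have "{j. k \<le> j \<and> j < length w \<and> w ! j = Close} \<subseteq> snd ` ?B"
  proof clarify
    fix j assume j: "k \<le> j" "j < length w" "w ! j = Close"
    then obtain i where i: "paired w i j" using closes by blast
    then have "k \<le> i" using nocross j(1) by (meson not_less)
    then show "j \<in> snd ` ?B" using i by force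
  qed
  then have "count_list (drop k w) Close \<le> card ?B"
    unfolding count_list_drop_eq_card[OF k(1)] by (rule surj_card_le[rotated]) (simp add: finite_paired)
  moreover have "card ?A + card ?B = card (?A \<union> ?B)"
    by (rule card_Un_disjoint[symmetric]) (auto simp: finite_paired)
  moreover have "?A \<union> ?B = ?P" by auto
  ultimately show ?thesis using that k(1) by simp
qed

section \<open>The minimum formula for a column\<close>

text \<open>Lifts a cut of the word to a cut of the list of rows; no cut falls inside a row because
  each row yields at most one token.\<close>

lemma take_drop_concat_map:
  assumes "\<And>x. length (f x) \<le> 1" "k \<le> length (concat (map f xs))"
  shows "\<exists>m \<le> length xs. take k (concat (map f xs)) = concat (map f (take m xs)) \<and>
    drop k (concat (map f xs)) = concat (map f (drop m xs))"
  using assms(2)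
proof (induction xs arbitrary: k)
  case (Cons x xs)
  show ?case
  proof (cases "k < length (f x)")
    case True
    then have "k = 0" using assms(1)[of x] by linarith
    then show ?thesis by (intro exI[of _ 0]) auto
  next
    case False
    have "k - length (f x) \<le> length (concat (map f xs))" using Cons.prems by simp
    from Cons.IH[OF this] obtain m where "m \<le> length xs"
      "take (k - length (f x)) (concat (map f xs)) = concat (map f (take m xs))"
      "drop (k - length (f x)) (concat (map f xs)) = concat (map f (drop m xs))" by blast
    then show ?thesis using False by (intro exI[of _ "Suc m"]) auto
  qed
qed simp

context
  fixes n :: nat and D :: "box set" and c :: nat and S :: "nat set"
begin

text \<open>The contribution of one row to \<open>column_word\<close>, named so that words of
  intervals of rows can be formed.\<close>

definition token_at :: "nat \<Rightarrow> token list" where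
  "token_at r = (if (r, c) \<notin> D \<and> r \<in> S then [Open]
     else if (r, c) \<in> D \<and> r \<notin> S then [Close]
     else if (r, c) \<in> D \<and> r \<in> S then [Star]
     else [])"

text \<open>A row yields \<open>Open\<close> or \<open>Star\<close> exactly when it is in
  \<open>S\<close>, whatever \<open>D\<close> is. Dually, \<open>Close\<close> or
  \<open>Star\<close> detects \<open>D\<close> alone.\<close>

lemma count_Open_Star:
  "distinct xs \<Longrightarrow> count_list (concat (map token_at xs)) Open +
    count_list (concat (map token_at xs)) Star = card (set xs \<inter> S)"
  by (induction xs) (auto simp: token_at_def Int_insert_left)

lemma count_Close_Star:
  "distinct xs \<Longrightarrow> count_list (concat (map token_at xs)) Close +
    count_list (concat (map token_at xs)) Star = card {r \<in> set xs. (r, c) \<in> D}"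
proof (induction xs)
  case (Cons x xs)
  have "{r \<in> set (x # xs). (r, c) \<in> D} =
    (if (x, c) \<in> D then insert x {r \<in> set xs. (r, c) \<in> D} else {r \<in> set xs. (r, c) \<in> D})" by auto
  then show ?case using Cons by (auto simp: token_at_def)
qed simp

lemma column_word_eq: "column_word n D c S = concat (map token_at [1..<Suc n])"
  unfolding column_word_def token_at_def by simp

text \<open>The stars are shared out at the cut: those above row \<open>m\<close> join the openings,
  the others join the closings.\<close>

lemma count_split:
  assumes "1 \<le> m" "m \<le> Suc n"
  shows "count_list (column_word n D c S) Star + (count_list (concat (map token_at [1..<m])) Open
     + count_list (concat (map token_at [m..<Suc n])) Close)
   = card ({1..<m} \<inter> S) + card {r \<in> {m..n}. (r, c) \<in> D}"
proof -
  have "[1..<Suc n] = [1..<m] @ [m..<Suc n]"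
    using assms by (metis le_add_diff_inverse upt_add_eq_append)
  then have "count_list (column_word n D c S) Star = count_list (concat (map token_at [1..<m])) Star
      + count_list (concat (map token_at [m..<Suc n])) Star"
    unfolding column_word_eq by simp
  moreover have "{r \<in> {m..n}. (r, c) \<in> D} = {r \<in> set [m..<Suc n]. (r, c) \<in> D}" by auto
  ultimately show ?thesis
    using count_Open_Star[of "[1..<m]"] count_Close_Star[of "[m..<Suc n]"]
    by (simp del: upt_Suc)
qed

lemma theta_col_le:
  assumes "1 \<le> m" "m \<le> Suc n"
  shows "theta_col n D c S \<le> card ({1..<m} \<inter> S) + card {r \<in> {m..n}. (r, c) \<in> D}"
proof -
  let ?k = "length (concat (map token_at [1..<m]))"
  have "column_word n D c S = concat (map token_at [1..<m]) @ concat (map token_at [m..<Suc n])"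
    using assms unfolding column_word_eq
    by (metis concat_append le_add_diff_inverse map_append upt_add_eq_append)
  then show ?thesis
    using card_paired_le[of ?k "column_word n D c S"] count_split[OF assms]
    unfolding theta_col_def by simp
qed

lemma theta_col_ge:
  obtains m where "1 \<le> m" "m \<le> Suc n"
    "card ({1..<m} \<inter> S) + card {r \<in> {m..n}. (r, c) \<in> D} \<le> theta_col n D c S"
proof -
  let ?w = "column_word n D c S"
  obtain k where k: "k \<le> length ?w"
    "count_list (take k ?w) Open + count_list (drop k ?w) Close \<le> card {(i, j). paired ?w i j}"
    by (rule card_paired_ge)
  have "length (token_at r) \<le> 1" for r by (simp add: token_at_def)
  from take_drop_concat_map[of token_at, OF this k(1)[unfolded column_word_eq]]
  obtain m where m: "m \<le> n" "take k ?w = concat (map token_at (take m [1..<Suc n]))"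
    "drop k ?w = concat (map token_at (drop m [1..<Suc n]))"
    unfolding column_word_eq by (auto simp del: upt_Suc)
  \<comment> \<open>Rows are numbered from 1, so a prefix of \<open>m\<close> rows puts the boundary
    at row \<open>Suc m\<close>.\<close>
  have "take m [1..<Suc n] = [1..<Suc m]" "drop m [1..<Suc n] = [Suc m..<Suc n]"
    using m(1) by (simp_all add: take_upt del: upt_Suc)
  then have "card ({1..<Suc m} \<inter> S) + card {r \<in> {Suc m..n}. (r, c) \<in> D} \<le> theta_col n D c S"
    using count_split[of "Suc m"] k(2) m unfolding theta_col_def by simp
  then show ?thesis using that[of "Suc m"] m(1) by simp
qed

end

section \<open>Perfect tableaux as matchings\<close>

lemma sum_card_fibres:
  assumes "finite A" "finite I"
  shows "(\<Sum>i\<in>I. card {x \<in> A. g x = i}) = card {x \<in> A. g x \<in> I}"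
proof -
  have "card (\<Union>i\<in>I. {x \<in> A. g x = i}) = (\<Sum>i\<in>I. card {x \<in> A. g x = i})"
    by (rule card_UN_disjoint) (use assms in auto)
  moreover have "(\<Union>i\<in>I. {x \<in> A. g x = i}) = {x \<in> A. g x \<in> I}" by auto
  ultimately show ?thesis by simp
qed

text \<open>Take the minimising \<open>m\<close>. Entries below \<open>m\<close> are distinct
  elements of \<open>S\<close>, and by the flag condition entries from \<open>m\<close> on sit in
  rows from \<open>m\<close> on.\<close>

lemma card_column_entries_le:
  assumes D: "D \<subseteq> {1..n} \<times> {1..n}" and pos: "\<And>b. b \<in> D \<Longrightarrow> 1 \<le> v b"
    and flag: "\<And>b. b \<in> D \<Longrightarrow> v b \<le> fst b"
    and inj: "inj_on v {b \<in> D. snd b = c}"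
  shows "card {b \<in> D. v b \<in> S \<and> snd b = c} \<le> theta_col n D c S"
proof -
  have finD: "finite D" using D by (rule finite_subset) simp
  obtain m where m: "1 \<le> m" "m \<le> Suc n"
    "card ({1..<m} \<inter> S) + card {r \<in> {m..n}. (r, c) \<in> D} \<le> theta_col n D c S"
    by (rule theta_col_ge)
  let ?E = "{b \<in> D. v b \<in> S \<and> snd b = c}"
  have "card ?E \<le> card ({b \<in> ?E. v b < m} \<union> {b \<in> ?E. m \<le> v b})"
    by (rule card_mono) (use finD in auto)
  also have "\<dots> \<le> card {b \<in> ?E. v b < m} + card {b \<in> ?E. m \<le> v b}" by (rule card_Un_le)
  also have "card {b \<in> ?E. v b < m} \<le> card ({1..<m} \<inter> S)"
    by (rule card_inj_on_le[of v]) (use pos in \<open>auto intro: inj_on_subset[OF inj]\<close>)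
  also have "card {b \<in> ?E. m \<le> v b} \<le> card {r \<in> {m..n}. (r, c) \<in> D}"
  proof (rule card_inj_on_le[of fst])
    show "fst ` {b \<in> ?E. m \<le> v b} \<subseteq> {r \<in> {m..n}. (r, c) \<in> D}"
      using flag D by fastforce
  qed (auto simp: inj_on_def)
  finally show ?thesis using m(3) by simp
qed

text \<open>Double counting of the boxes with entry in \<open>S\<close>: by value they give the
  content sum, by column they are bounded by \<open>theta_col\<close>.\<close>

lemma schubitope_if_perfect_tab:
  assumes D: "D \<subseteq> {1..n} \<times> {1..n}" and \<tau>: "\<tau> \<in> perfect_tab n D \<alpha>"
  shows "(\<Sum>i=1..n. \<alpha> i) = card D" and "S \<subseteq> {1..n} \<Longrightarrow> (\<Sum>i\<in>S. \<alpha> i) \<le> theta n D S"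
proof -
  have finD: "finite D" using D by (rule finite_subset) simp
  define v where "v b = the (\<tau> b)" for b
  have tab: "\<tau> \<in> tableaux n D" and fl: "flagged D \<tau>" and ci: "column_injective D \<tau>"
    and lab: "{b \<in> D. \<tau> b = None} = {}" and cont: "has_content n D \<tau> \<alpha>"
    using \<tau> unfolding perfect_tab_def perfect_def by auto
  have \<tau>v: "\<tau> b = Some (v b)" if "b \<in> D" for b
  proof -
    have "b \<notin> {b \<in> D. \<tau> b = None}" unfolding lab by simp
    then show ?thesis using that unfolding v_def by simp
  qed
  have range: "v b \<in> {1..n}" if "b \<in> D" for b
    using PiE_mem[OF tab[unfolded tableaux_def] that] \<tau>v[OF that] by auto
  have flag: "v b \<le> fst b" if "b \<in> D" for b
    using fl that \<tau>v[OF that] unfolding flagged_def by (cases b) auto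
  have inj: "inj_on v {b \<in> D. snd b = c}" for c
  proof (rule inj_onI)
    fix b b' assume b: "b \<in> {b \<in> D. snd b = c}" "b' \<in> {b \<in> D. snd b = c}" "v b = v b'"
    then have "\<tau> b = \<tau> b'" "\<tau> b \<noteq> None" using \<tau>v by auto
    then show "b = b'" using ci b(1,2) unfolding column_injective_def by (cases b; cases b') force
  qed
  have content: "\<alpha> i = card {b \<in> D. v b = i}" if "i \<in> {1..n}" for i
  proof -
    have "\<alpha> i = card {b \<in> D. \<tau> b = Some i}"
      using cont that unfolding has_content_def by simp
    also have "{b \<in> D. \<tau> b = Some i} = {b \<in> D. v b = i}" using \<tau>v by auto
    finally show ?thesis .
  qed
  have sum: "(\<Sum>i\<in>S. \<alpha> i) = card {b \<in> D. v b \<in> S}" if S: "S \<subseteq> {1..n}" for S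
  proof -
    have "(\<Sum>i\<in>S. \<alpha> i) = (\<Sum>i\<in>S. card {b \<in> D. v b = i})"
      using S by (intro sum.cong refl content) auto
    then show ?thesis using sum_card_fibres[OF finD, of S v] S finite_subset by fastforce
  qed
  have "{b \<in> D. v b \<in> {1..n}} = D" using range by blast
  then show "(\<Sum>i=1..n. \<alpha> i) = card D" using sum[of "{1..n}"] by simp
  assume S: "S \<subseteq> {1..n}"
  let ?E = "{b \<in> D. v b \<in> S}"
  have "card ?E = card {b \<in> ?E. snd b \<in> {1..n}}"
    using D by (intro arg_cong[of _ _ card]) auto
  also have "\<dots> = (\<Sum>c=1..n. card {b \<in> ?E. snd b = c})"
    using finD by (intro sum_card_fibres[symmetric]) auto
  also have "\<dots> \<le> theta n D S"
    unfolding theta_def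
  proof (rule sum_mono)
    fix c
    have "{b \<in> ?E. snd b = c} = {b \<in> D. v b \<in> S \<and> snd b = c}" by auto
    then show "card {b \<in> ?E. snd b = c} \<le> theta_col n D c S"
      using card_column_entries_le[OF D _ flag inj] range by simp
  qed
  finally show "(\<Sum>i\<in>S. \<alpha> i) \<le> theta n D S" using sum[OF S] by simp
qed

section \<open>Sufficiency: a matching in the flow graph yields a tableau\<close>

text \<open>The left vertices are the copies \<open>Inl (i, k)\<close>, \<open>k < \<alpha> i\<close>, of the value \<open>i\<close> and the exits \<open>Inr (c, i)\<close>;
  the right vertices are the entrances \<open>Inl (c, i)\<close> and the boxes, written \<open>Inr (c, r)\<close>. An exit
  matched to its own entrance stands for a value not used in that column.\<close>

definition nbrs :: "nat \<Rightarrow> box set \<Rightarrow> nat \<times> nat + nat \<times> nat \<Rightarrow> (nat \<times> nat + nat \<times> nat) set" where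
  "nbrs n D x = (case x of Inl (i, k) \<Rightarrow> (\<lambda>c. Inl (c, i)) ` {1..n}
     | Inr (c, i) \<Rightarrow> insert (Inl (c, i)) (Inr ` Pair c ` {r. i \<le> r \<and> (r, c) \<in> D}))"

text \<open>Hall's condition within one column, where \<open>I\<close> holds the values with a
  chosen copy and \<open>J\<close> the chosen exits. Their neighbours are the entrances
  \<open>I \<union> J\<close> and the boxes from row \<open>Min J\<close> on. For
  \<open>m = Min J\<close>, the part of \<open>I\<close> below \<open>m\<close> is disjoint from
  \<open>J\<close>, so the minimum formula leaves room for \<open>card J\<close>.\<close>

lemma theta_col_Hall:
  assumes J: "J \<subseteq> {1..n}" and I: "finite I"
  obtains m where "m = Suc n \<or> m \<in> J"
    "theta_col n D c I + card J \<le> card (I \<union> J) + card {r \<in> {m..n}. (r, c) \<in> D}"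
proof -
  have finJ: "finite J" using J finite_subset by blast
  \<comment> \<open>Without exits no box is reachable, and \<open>Suc n\<close> makes the range of
    rows empty.\<close>
  define m where "m = (if J = {} then Suc n else Min J)"
  have m: "m = Suc n \<or> m \<in> J" unfolding m_def using finJ by simp
  have "1 \<le> m" "m \<le> Suc n" using m J by auto
  then have "theta_col n D c I \<le> card ({1..<m} \<inter> I) + card {r \<in> {m..n}. (r, c) \<in> D}"
    by (rule theta_col_le)
  moreover have "m \<le> i" if "i \<in> J" for i unfolding m_def using finJ that by auto
  then have "({1..<m} \<inter> I) \<inter> J = {}" by fastforce
  then have "card ({1..<m} \<inter> I) + card J = card (({1..<m} \<inter> I) \<union> J)"
    using finJ I by (intro card_Un_disjoint[symmetric]) auto
  moreover have "\<dots> \<le> card (I \<union> J)"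
    using finJ I by (intro card_mono) auto
  ultimately show ?thesis using that m by fastforce
qed

lemma nbrs_Hall:
  assumes D: "D \<subseteq> {1..n} \<times> {1..n}"
    and \<theta>: "\<And>S. S \<subseteq> {1..n} \<Longrightarrow> (\<Sum>i\<in>S. \<alpha> i) \<le> theta n D S"
    and X: "X \<subseteq> (SIGMA i:{1..n}. {..<\<alpha> i}) <+> {1..n} \<times> {1..n}"
  shows "card X \<le> card (\<Union>(nbrs n D ` X))"
proof -
  have finD: "finite D" using D by (rule finite_subset) simp
  define P where "P = Inl -` X"
  define Q where "Q = Inr -` X"
  have XPQ: "X = P <+> Q" unfolding P_def Q_def
    by (auto simp: Plus_def) (metis sum.exhaust rangeI vimageI image_eqI)
  have P: "P \<subseteq> (SIGMA i:{1..n}. {..<\<alpha> i})" and Q: "Q \<subseteq> {1..n} \<times> {1..n}"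
    using X unfolding P_def Q_def by auto
  have finP: "finite P" using P by (rule finite_subset) simp
  have finQ: "finite Q" using Q by (rule finite_subset) simp
  define I where "I = fst ` P"
  have I: "I \<subseteq> {1..n}" "finite I" using P finP unfolding I_def by auto
  have col: "Q `` {c} \<subseteq> {1..n}" for c using Q by auto
  have "\<forall>c. \<exists>m. (m = Suc n \<or> m \<in> Q `` {c}) \<and> theta_col n D c I + card (Q `` {c})
      \<le> card (I \<union> Q `` {c}) + card {r \<in> {m..n}. (r, c) \<in> D}"
  proof
    fix c
    show "\<exists>m. (m = Suc n \<or> m \<in> Q `` {c}) \<and> theta_col n D c I + card (Q `` {c})
      \<le> card (I \<union> Q `` {c}) + card {r \<in> {m..n}. (r, c) \<in> D}"
      by (rule theta_col_Hall[OF col I(2)]) blast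
  qed
  then obtain m where "\<forall>c. (m c = Suc n \<or> m c \<in> Q `` {c}) \<and> theta_col n D c I + card (Q `` {c})
      \<le> card (I \<union> Q `` {c}) + card {r \<in> {m c..n}. (r, c) \<in> D}"
    by (rule choice[THEN exE])
  then have m: "m c = Suc n \<or> m c \<in> Q `` {c}" "theta_col n D c I + card (Q `` {c})
      \<le> card (I \<union> Q `` {c}) + card {r \<in> {m c..n}. (r, c) \<in> D}" for c
    by simp_all
  \<comment> \<open>The neighbours counted by \<open>theta_col_Hall\<close>, collected over all
    columns: entrances on the left, boxes on the right.\<close>
  let ?W = "(SIGMA c:{1..n}. I \<union> Q `` {c}) <+> (SIGMA c:{1..n}. {r \<in> {m c..n}. (r, c) \<in> D})"
  have "card P \<le> card (SIGMA i:I. {..<\<alpha> i})"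
  proof (rule card_mono)
    show "P \<subseteq> (SIGMA i:I. {..<\<alpha> i})" using P unfolding I_def by force
  qed (use I in auto)
  also have "\<dots> = (\<Sum>i\<in>I. \<alpha> i)" using I by simp
  also have "\<dots> \<le> theta n D I" by (rule \<theta>) (rule I)
  finally have cP: "card P \<le> (\<Sum>c=1..n. theta_col n D c I)" unfolding theta_def .
  have "Q = (SIGMA c:{1..n}. Q `` {c})" using Q by auto
  then have "card Q = card (SIGMA c:{1..n}. Q `` {c})" by simp
  also have "\<dots> = (\<Sum>c=1..n. card (Q `` {c}))"
    by (rule card_SigmaI) (use finQ in auto)
  finally have "card Q = (\<Sum>c=1..n. card (Q `` {c}))" .
  then have "card X \<le> (\<Sum>c=1..n. theta_col n D c I + card (Q `` {c}))"
    using cP finP finQ unfolding XPQ by (simp add: card_Plus sum.distrib)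
  also have "\<dots> \<le> (\<Sum>c=1..n. card (I \<union> Q `` {c}) + card {r \<in> {m c..n}. (r, c) \<in> D})"
    by (rule sum_mono) (rule m)
  also have "\<dots> = card ?W"
    using I(2) finQ by (simp add: card_Plus sum.distrib finite_SigmaI)
  also have "\<dots> \<le> card (\<Union>(nbrs n D ` X))"
  proof (rule card_mono)
    have "finite {r. i \<le> r \<and> (r, c) \<in> D}" for i c
      by (rule finite_subset[of _ "fst ` D"]) (use finD in force)+
    then have "finite (nbrs n D x)" for x
      unfolding nbrs_def by (auto split: sum.split)
    then show "finite (\<Union>(nbrs n D ` X))" using finP finQ unfolding XPQ by auto
    have 1: "Inl (c, i) \<in> nbrs n D (Inl (i, k))" if "c \<in> {1..n}" for c i k
      using that unfolding nbrs_def by simp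
    have 2: "Inl (c, i) \<in> nbrs n D (Inr (c, i))" for c i unfolding nbrs_def by simp
    have 3: "Inr (c, r) \<in> nbrs n D (Inr (c, i))" if "(r, c) \<in> D" "i \<le> r" for c i r
      using that unfolding nbrs_def by simp
    \<comment> \<open>A nonempty range of rows excludes the default \<open>Suc n\<close>, so
      \<open>m c\<close> is a chosen exit that reaches all these boxes.\<close>
    have "(c, m c) \<in> Q" if "m c \<le> r" "r \<le> n" for c r using m(1)[of c] that by auto
    then show "?W \<subseteq> \<Union>(nbrs n D ` X)"
      unfolding XPQ I_def using 1 2 3 by (fastforce simp: Plus_def)
  qed
  finally show ?thesis .
qed

text \<open>The matching is a bijection. The label of a box is the value of the exit matched to it,
  and each copy of a value that occupies an entrance forces the exit behind it into a box.\<close>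

lemma perfect_tab_if_schubitope:
  assumes D: "D \<subseteq> {1..n} \<times> {1..n}" and total: "(\<Sum>i=1..n. \<alpha> i) = card D"
    and \<theta>: "\<And>S. S \<subseteq> {1..n} \<Longrightarrow> (\<Sum>i\<in>S. \<alpha> i) \<le> theta n D S"
  shows "perfect_tab n D \<alpha> \<noteq> {}"
proof -
  have finD: "finite D" using D by (rule finite_subset) simp
  let ?A = "(SIGMA i:{1..n}. {..<\<alpha> i}) <+> {1..n} \<times> {1..n}"
  let ?B = "{1..n} \<times> {1..n} <+> prod.swap ` D"
  have finB: "finite ?B" using finD by simp
  have N: "nbrs n D x \<subseteq> ?B" if "x \<in> ?A" for x
    using that D unfolding nbrs_def by auto
  have "\<exists>f. inj_on f ?A \<and> (\<forall>x\<in>?A. f x \<in> nbrs n D x)"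
  proof (rule hall)
    show "finite (nbrs n D x)" if "x \<in> ?A" for x
      using N[OF that] finB by (rule finite_subset)
  qed (use nbrs_Hall[OF D \<theta>] in auto)
  then obtain f where f: "inj_on f ?A" "\<And>x. x \<in> ?A \<Longrightarrow> f x \<in> nbrs n D x" by blast
  \<comment> \<open>Since the content sums to \<open>card D\<close>, both sides have equal size, and
    the injection hits every box.\<close>
  have "card ?A = card ?B"
    using total finD by (simp add: card_Plus card_image)
  moreover have "f ` ?A \<subseteq> ?B" using f(2) N by blast
  ultimately have surj: "f ` ?A = ?B"
    using finB f(1) by (metis card_image card_subset_eq)
  have AL: "Inl (i, k) \<in> ?A" if "i \<in> {1..n}" "k < \<alpha> i" for i k
    using that by (intro InlI) auto
  have AR: "Inr (c, i) \<in> ?A" if "i \<in> {1..n}" "c \<in> {1..n}" for c i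
    using that by (intro InrI) auto
  have copy: "\<exists>c\<in>{1..n}. f (Inl (i, k)) = Inl (c, i)" if "i \<in> {1..n}" "k < \<alpha> i" for i k
    using f(2)[OF AL[OF that]] unfolding nbrs_def by auto
  have exit: "f (Inr (c, i)) = Inl (c, i) \<or> (\<exists>r. i \<le> r \<and> (r, c) \<in> D \<and> f (Inr (c, i)) = Inr (c, r))"
    if "i \<in> {1..n}" "c \<in> {1..n}" for i c
    using f(2)[OF AR[OF that]] unfolding nbrs_def by auto
  \<comment> \<open>Copies are adjacent to entrances only, so a box is hit by an exit of its own
    column.\<close>
  have "\<forall>b\<in>D. \<exists>i. i \<in> {1..n} \<and> i \<le> fst b \<and> f (Inr (snd b, i)) = Inr (snd b, fst b)"
  proof
    fix b assume "b \<in> D"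
    then have "Inr (snd b, fst b) \<in> f ` ?A" unfolding surj by (cases b) force
    then obtain x where x: "x \<in> ?A" "f x = Inr (snd b, fst b)" by (rule imageE) metis
    show "\<exists>i. i \<in> {1..n} \<and> i \<le> fst b \<and> f (Inr (snd b, i)) = Inr (snd b, fst b)"
      using x(1)
    proof (rule PlusE)
      fix y assume "y \<in> (SIGMA i:{1..n}. {..<\<alpha> i})" "x = Inl y"
      then show ?thesis using copy[of "fst y" "snd y"] x(2) by auto
    next
      fix y assume y: "y \<in> {1..n} \<times> {1..n}" "x = Inr y"
      then have "snd y \<in> {1..n}" "fst y \<in> {1..n}" by auto
      with exit[OF this] y x(2) show ?thesis by (intro exI[of _ "snd y"]) auto
    qed
  qed
  then obtain v where v: "\<And>b. b \<in> D \<Longrightarrow> v b \<in> {1..n}" "\<And>b. b \<in> D \<Longrightarrow> v b \<le> fst b"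
    "\<And>b. b \<in> D \<Longrightarrow> f (Inr (snd b, v b)) = Inr (snd b, fst b)"
    by metis
  have le: "\<alpha> i \<le> card {b \<in> D. v b = i}" if i: "i \<in> {1..n}" for i
  proof -
    have "\<exists>b. b \<in> D \<and> v b = i \<and> f (Inl (i, k)) = Inl (snd b, i)" if k: "k < \<alpha> i" for k
    proof -
      obtain c where c: "c \<in> {1..n}" "f (Inl (i, k)) = Inl (c, i)" using copy[OF i k] by blast
      \<comment> \<open>The copy has taken the entrance, so the exit cannot stay at home and must go
        to a box, which is then labelled \<open>i\<close>.\<close>
      have "f (Inr (c, i)) \<noteq> f (Inl (i, k))"
        using inj_onD[OF f(1) _ AR[OF i c(1)] AL[OF i k]] by blast
      then obtain r where r: "(r, c) \<in> D" "f (Inr (c, i)) = Inr (c, r)" using exit[OF i c(1)] c by auto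
      have "f (Inr (c, v (r, c))) = f (Inr (c, i))" using v(3)[OF r(1)] r(2) by simp
      then have "v (r, c) = i"
        using inj_onD[OF f(1) _ AR[OF v(1)[OF r(1)] c(1)] AR[OF i c(1)]] by simp
      then show ?thesis using r c by force
    qed
    then obtain b where b: "\<And>k. k < \<alpha> i \<Longrightarrow> b k \<in> D \<and> v (b k) = i \<and> f (Inl (i, k)) = Inl (snd (b k), i)"
      by metis
    have "inj_on b {..<\<alpha> i}"
    proof (rule inj_onI)
      fix k k' assume k: "k \<in> {..<\<alpha> i}" "k' \<in> {..<\<alpha> i}" "b k = b k'"
      then have "f (Inl (i, k)) = f (Inl (i, k'))" using b by simp
      then show "k = k'" using inj_onD[OF f(1) _ AL[OF i] AL[OF i]] k(1,2) by simp
    qed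
    moreover have "b ` {..<\<alpha> i} \<subseteq> {b \<in> D. v b = i}" using b by auto
    ultimately have "card {..<\<alpha> i} \<le> card {b \<in> D. v b = i}"
      by (rule card_inj_on_le) (use finD in simp)
    then show ?thesis by simp
  qed
  have "{b \<in> D. v b \<in> {1..n}} = D" using v(1) by blast
  then have "(\<Sum>i=1..n. \<alpha> i) = (\<Sum>i=1..n. card {b \<in> D. v b = i})"
    using total sum_card_fibres[OF finD, of "{1..n}" v] by simp
  \<comment> \<open>The termwise inequalities \<open>le\<close> have equal sums, so each is an
    equality.\<close>
  then have content: "\<alpha> i = card {b \<in> D. v b = i}" if "i \<in> {1..n}" for i
    using sum_mono_inv[of \<alpha> "{1..n}" "\<lambda>i. card {b \<in> D. v b = i}" i] le that by blast
  define \<tau> where "\<tau> = (\<lambda>b\<in>D. Some (v b))"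
  have "\<tau> \<in> tableaux n D" unfolding \<tau>_def tableaux_def using v(1) by auto
  moreover have "flagged D \<tau>" unfolding \<tau>_def flagged_def using v(2) by fastforce
  \<comment> \<open>Equal labels in one column name the same exit, which \<open>f\<close> sends to a
    single box.\<close>
  moreover have "column_injective D \<tau>"
    unfolding column_injective_def \<tau>_def using v(3) by clarsimp (metis Pair_inject fst_conv snd_conv sum.inject(2))
  moreover have "{b \<in> D. \<tau> b = None} = {}" unfolding \<tau>_def by auto
  moreover have "{b \<in> D. \<tau> b = Some i} = {b \<in> D. v b = i}" for i unfolding \<tau>_def by auto
  then have "has_content n D \<tau> \<alpha>" unfolding has_content_def using content by simp
  ultimately show ?thesis unfolding perfect_tab_def perfect_def by blast
qed

theorem theorem3p5:
  fixes n :: nat and D :: "(nat \<times> nat) set" and \<alpha> :: "nat \<Rightarrow> nat"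
  assumes "n > 0" and "D \<subseteq> {1..n} \<times> {1..n}"
  shows "(\<lambda>i\<in>{1..n}. real (\<alpha> i)) \<in> schubitope n D \<longleftrightarrow> perfect_tab n D \<alpha> \<noteq> {}"
proof -
  let ?a = "\<lambda>i\<in>{1..n}. real (\<alpha> i)"
  have "sum ?a S = real (\<Sum>i\<in>S. \<alpha> i)" if "S \<subseteq> {1..n}" for S
    using that unfolding of_nat_sum by (intro sum.cong) auto
  moreover have "?a \<in> {1..n} \<rightarrow>\<^sub>E {0..}" by auto
  ultimately have "?a \<in> schubitope n D \<longleftrightarrow>
      (\<Sum>i=1..n. \<alpha> i) = card D \<and> (\<forall>S\<subseteq>{1..n}. (\<Sum>i\<in>S. \<alpha> i) \<le> theta n D S)"
    unfolding schubitope_def by (simp del: of_nat_sum restrict_apply)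
  then show ?thesis
    using perfect_tab_if_schubitope[OF assms(2)] schubitope_if_perfect_tab[OF assms(2)] by blast
qed

end
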